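(* Let $0<\alpha<1$ and $0<\lambda_{-1}<\lambda_g$. Let $\{x^k\}_{k=0}^\infty$ be a sequence of iterates generated by the linesearch anisotropic proximal gradient method and denote by $\{\lambda_k\}_{k=0}^\infty$ the corresponding sequence of step-sizes. Then the sequence $\{F(x^k)\}_{k=0}^\infty$ is nonincreasing and convergent. In addition, every limit point $x^\star$ of $\{x^k\}_{k=0}^\infty$ is a stationary point of $F$, i.e., $0\in\nabla f(x^\star)+\partial g(x^\star)$. In particular, the minimum over the past regularized gaps vanishes sublinearly at rate $\mathcal{O}(1/K)$: for every $K\ge1$ $$\min_{k\in\{0,1,\ldots,K-1\}}\mathcal{G}_F^\phi(x^k,\lambda_{\min})\le\frac{1}{K\lambda_{\min}}\big(F(x^0)-\inf F\big),$$ where $\lambda_{\min}:=\min\{\lambda_{-1},\alpha/L\}$.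
   Context: Reference function: $\phi:\mathbb{R}^n\to\mathbb{R}$ is convex with full domain and Legendre (essentially smooth and essentially strictly convex in the sense of Rockafellar); so $\nabla\phi:\mathbb{R}^n\to\operatorname{int}\operatorname{dom}\phi^*$ is a bijection with inverse $\nabla\phi^*$ ($\phi^*$ the convex conjugate). For $\lambda>0$, $(\lambda\star\phi)(x)=\lambda\phi(\lambda^{-1}x)$. Anisotropic descent property of $f\in\mathcal{C}^1(\mathbb{R}^n)$ relative to $\phi$ with constant $L>0$: $\operatorname{rge}\nabla f\subseteq\operatorname{rge}\nabla\phi$ (rge = range) and for all $\bar x,x\in\mathbb{R}^n$ $$f(x)\le f(\bar x)+\tfrac1L\star\phi\big(x-\bar x+L^{-1}\nabla\phi^*(\nabla f(\bar x))\big)-\tfrac1L\star\phi\big(L^{-1}\nabla\phi^*(\nabla f(\bar x))\big).$$ Problem: minimize $F:=f+g$, where $f\in\mathcal{C}^1(\mathbb{R}^n)$ has the anisotropic descent property relative to $\phi$ with constant $L>0$, $g:\mathbb{R}^n\to\overline{\mathbb{R}}$ is proper lower semicontinuous (not necessarily convex), and $\inf F>-\infty$. $\partial g$ is the limiting (Mordukhovich) subdifferential. Define $\lambda_g:=\sup\{\lambda>0: g+\lambda\star\phi(\cdot-y)\text{ is level-bounded for every }y\in\mathbb{R}^n\}$ (level-bounded: all sublevel sets are bounded); assume $\lambda_g>0$. Linesearch anisotropic proximal gradient method: given $0<\alpha<1$, $0<\lambda_{-1}<\lambda_g$ and $x^0\in\mathbb{R}^n$, for $k=0,1,\ldots$ do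 the following. For $t=0,1,2,\ldots$ set $\lambda_k\leftarrow\alpha^t\lambda_{k-1}$, $y^k\leftarrow x^k-\lambda_k\nabla\phi^*(\nabla f(x^k))$, and choose $x^{k+1}\in\operatorname*{arg\,min}_{x\in\mathbb{R}^n}\{\lambda_k\star\phi(x-y^k)+g(x)\}$, stopping at the first $t$ for which $$f(x^{k+1})\le f(x^k)+\lambda_k\star\phi(x^{k+1}-y^k)-\lambda_k\star\phi\big(\lambda_k\nabla\phi^*(\nabla f(x^k))\big).$$ After this inner loop has stopped (with $x^{k+1}$ accepted), if $\lambda_k/\alpha<\lambda_g$ then replace $\lambda_k\leftarrow\lambda_k/\alpha$ (this only affects the starting trial step-size of the next iteration). Regularized gap: for $0<\lambda<\lambda_g$, $\mathcal{G}_F^\phi(\bar x,\lambda):=\tfrac1\lambda\big(F(\bar x)-F_\lambda(\bar x)\big)$, where $$F_\lambda(\bar x):=\inf_{x\in\mathbb{R}^n}\Big\{f(\bar x)+\lambda\star\phi\big(x-\bar x+\lambda\nabla\phi^*(\nabla f(\bar x))\big)-\lambda\star\phi\big(\lambda\nabla\phi^*(\nabla f(\bar x))\big)+g(x)\Big\}.$$ *)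

theory Defs
  imports "HOL-Analysis.Analysis"
begin

section \<open>Extended-real-valued functions\<close>

definition edomain :: "('a \<Rightarrow> ereal) \<Rightarrow> 'a set" where
  "edomain h = {x. h x < \<infinity>}"

definition proper_fun :: "('a \<Rightarrow> ereal) \<Rightarrow> bool" where
  "proper_fun h \<longleftrightarrow> (\<forall>x. h x \<noteq> -\<infinity>) \<and> edomain h \<noteq> {}"

definition lsc_fun :: "('a::t2_space \<Rightarrow> ereal) \<Rightarrow> bool" where
  "lsc_fun h \<longleftrightarrow> (\<forall>x. h x \<le> Liminf (at x) h)"

definition level_bounded :: "('a::metric_space \<Rightarrow> ereal) \<Rightarrow> bool" where
  "level_bounded h \<longleftrightarrow> (\<forall>c::real. bounded {x. h x \<le> ereal c})"

definition argmin_set :: "('a \<Rightarrow> ereal) \<Rightarrow> 'a set" where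
  "argmin_set h = {x. is_arg_min h (\<lambda>_. True) x}"

definition convex_fun :: "('a::real_vector \<Rightarrow> ereal) \<Rightarrow> bool" where
  "convex_fun h \<longleftrightarrow> convex {(x, r::real). h x \<le> ereal r}"

definition convex_subdiff :: "('a::real_inner \<Rightarrow> ereal) \<Rightarrow> 'a \<Rightarrow> 'a set" where
  "convex_subdiff h x = {v. \<forall>y. h x + ereal (v \<bullet> (y - x)) \<le> h y}"

definition conj_fun :: "('a::real_inner \<Rightarrow> ereal) \<Rightarrow> 'a \<Rightarrow> ereal" where
  "conj_fun h y = (SUP x. ereal (y \<bullet> x) - h x)"

definition gradient :: "('a::real_inner \<Rightarrow> real) \<Rightarrow> 'a \<Rightarrow> 'a" where
  "gradient f x = (THE D. GDERIV f x :> D)"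

text \<open>Differentiation is local, so on the interior of the domain of a proper function \<open>h\<close>
  the gradient of \<open>h\<close> is that of its real-valued truncation.\<close>

definition egradient :: "('a::real_inner \<Rightarrow> ereal) \<Rightarrow> 'a \<Rightarrow> 'a" where
  "egradient h = gradient (\<lambda>x. real_of_ereal (h x))"

definition C1_fun :: "('a::real_inner \<Rightarrow> real) \<Rightarrow> bool" where
  "C1_fun f \<longleftrightarrow> (\<forall>x. f differentiable (at x)) \<and> continuous_on UNIV (gradient f)"

section \<open>Legendre functions (Rockafellar, Convex Analysis, Section 26)\<close>

definition essentially_smooth :: "('a::real_inner \<Rightarrow> ereal) \<Rightarrow> bool" where
  "essentially_smooth h \<longleftrightarrow>
     interior (edomain h) \<noteq> {} \<and>
     (\<forall>x \<in> interior (edomain h). (\<lambda>z. real_of_ereal (h z)) differentiable (at x)) \<and>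
     (\<forall>xs x. (\<forall>i::nat. xs i \<in> interior (edomain h)) \<longrightarrow> xs \<longlonglongrightarrow> x \<longrightarrow>
        x \<in> frontier (interior (edomain h)) \<longrightarrow>
        filterlim (\<lambda>i. norm (egradient h (xs i))) at_top sequentially)"

definition strictly_convex_on :: "'a::real_vector set \<Rightarrow> ('a \<Rightarrow> ereal) \<Rightarrow> bool" where
  "strictly_convex_on S h \<longleftrightarrow>
     (\<forall>x\<in>S. \<forall>y\<in>S. \<forall>t::real. x \<noteq> y \<longrightarrow> 0 < t \<longrightarrow> t < 1 \<longrightarrow>
        h ((1 - t) *\<^sub>R x + t *\<^sub>R y) < ereal (1 - t) * h x + ereal t * h y)"

definition essentially_strictly_convex :: "('a::real_inner \<Rightarrow> ereal) \<Rightarrow> bool" where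
  "essentially_strictly_convex h \<longleftrightarrow>
     (\<forall>S. convex S \<longrightarrow> S \<subseteq> {x. convex_subdiff h x \<noteq> {}} \<longrightarrow> strictly_convex_on S h)"

definition legendre :: "('a::real_inner \<Rightarrow> ereal) \<Rightarrow> bool" where
  "legendre h \<longleftrightarrow> proper_fun h \<and> lsc_fun h \<and> convex_fun h \<and>
     essentially_smooth h \<and> essentially_strictly_convex h"

section \<open>Limiting subdifferential\<close>

definition regular_subdiff :: "('a::real_inner \<Rightarrow> ereal) \<Rightarrow> 'a \<Rightarrow> 'a set" where
  "regular_subdiff g x = {v. \<bar>g x\<bar> \<noteq> \<infinity> \<and>
     0 \<le> Liminf (at x) (\<lambda>y. (g y - g x - ereal (v \<bullet> (y - x))) / ereal (norm (y - x)))}"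

definition limiting_subdiff :: "('a::real_inner \<Rightarrow> ereal) \<Rightarrow> 'a \<Rightarrow> 'a set" where
  "limiting_subdiff g x = {v. \<bar>g x\<bar> \<noteq> \<infinity> \<and>
     (\<exists>xs vs. xs \<longlonglongrightarrow> x \<and> (\<lambda>i. g (xs i)) \<longlonglongrightarrow> g x \<and>
        (\<forall>i::nat. vs i \<in> regular_subdiff g (xs i)) \<and> vs \<longlonglongrightarrow> v)}"

section \<open>Anisotropic proximal gradient\<close>

definition episcale :: "real \<Rightarrow> ('a::real_vector \<Rightarrow> real) \<Rightarrow> 'a \<Rightarrow> real" where
  "episcale c \<phi> x = c * \<phi> (inverse c *\<^sub>R x)"

definition conj_gradient :: "('a::real_inner \<Rightarrow> real) \<Rightarrow> 'a \<Rightarrow> 'a" where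
  "conj_gradient \<phi> = egradient (conj_fun (\<lambda>x. ereal (\<phi> x)))"

definition anisotropic_descent ::
    "('a::real_inner \<Rightarrow> real) \<Rightarrow> ('a \<Rightarrow> real) \<Rightarrow> real \<Rightarrow> bool" where
  "anisotropic_descent \<phi> f L \<longleftrightarrow>
     range (gradient f) \<subseteq> range (gradient \<phi>) \<and>
     (\<forall>xb x. f x \<le> f xb
        + episcale (1 / L) \<phi> (x - xb + inverse L *\<^sub>R conj_gradient \<phi> (gradient f xb))
        - episcale (1 / L) \<phi> (inverse L *\<^sub>R conj_gradient \<phi> (gradient f xb)))"

definition objective :: "('a \<Rightarrow> real) \<Rightarrow> ('a \<Rightarrow> ereal) \<Rightarrow> 'a \<Rightarrow> ereal" where
  "objective f g x = ereal (f x) + g x"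

text \<open>The supremum \<open>\<lambda>\<^sub>g\<close> may be infinite.\<close>

definition prox_threshold :: "('a::real_normed_vector \<Rightarrow> real) \<Rightarrow> ('a \<Rightarrow> ereal) \<Rightarrow> ereal" where
  "prox_threshold \<phi> g = Sup {ereal l | l. 0 < l \<and>
     (\<forall>y. level_bounded (\<lambda>x. g x + ereal (episcale l \<phi> (x - y))))}"

definition forward_step ::
    "('a::real_inner \<Rightarrow> real) \<Rightarrow> ('a \<Rightarrow> real) \<Rightarrow> real \<Rightarrow> 'a \<Rightarrow> 'a" where
  "forward_step \<phi> f l x = x - l *\<^sub>R conj_gradient \<phi> (gradient f x)"

definition trial_points ::
    "('a::real_inner \<Rightarrow> real) \<Rightarrow> ('a \<Rightarrow> real) \<Rightarrow> ('a \<Rightarrow> ereal) \<Rightarrow> real \<Rightarrow> 'a \<Rightarrow> 'a set" where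
  "trial_points \<phi> f g l x =
     argmin_set (\<lambda>z. ereal (episcale l \<phi> (z - forward_step \<phi> f l x)) + g z)"

definition linesearch_accepts ::
    "('a::real_inner \<Rightarrow> real) \<Rightarrow> ('a \<Rightarrow> real) \<Rightarrow> real \<Rightarrow> 'a \<Rightarrow> 'a \<Rightarrow> bool" where
  "linesearch_accepts \<phi> f l x z \<longleftrightarrow>
     f z \<le> f x + episcale l \<phi> (z - forward_step \<phi> f l x)
       - episcale l \<phi> (l *\<^sub>R conj_gradient \<phi> (gradient f x))"

text \<open>One outer iteration, from the iterate \<open>x\<close> and the previous step-size \<open>lprev\<close> to the
  iterate \<open>x'\<close> and the step-size \<open>lnext\<close> that the next iteration starts from.  The inner loop
  stops at \<open>T\<close>, and \<open>z t\<close> is the minimizer selected in its trial \<open>t\<close>; since minimizers need not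
  be unique, each rejected trial is the rejection of the selected point only.\<close>

definition linesearch_step ::
    "('a::real_inner \<Rightarrow> real) \<Rightarrow> ('a \<Rightarrow> real) \<Rightarrow> ('a \<Rightarrow> ereal) \<Rightarrow> real \<Rightarrow>
     real \<Rightarrow> 'a \<Rightarrow> 'a \<Rightarrow> real \<Rightarrow> bool" where
  "linesearch_step \<phi> f g \<alpha> lprev x x' lnext \<longleftrightarrow>
     (\<exists>(T::nat) z.
        (\<forall>t\<le>T. z t \<in> trial_points \<phi> f g (\<alpha> ^ t * lprev) x) \<and>
        (\<forall>t<T. \<not> linesearch_accepts \<phi> f (\<alpha> ^ t * lprev) x (z t)) \<and>
        linesearch_accepts \<phi> f (\<alpha> ^ T * lprev) x (z T) \<and>
        x' = z T \<and>
        lnext = (if ereal (\<alpha> ^ T * lprev / \<alpha>) < prox_threshold \<phi> g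
                 then \<alpha> ^ T * lprev / \<alpha> else \<alpha> ^ T * lprev))"

text \<open>In the following, \<open>l0\<close> is the initial step-size \<open>\<lambda>\<^sub>-\<^sub>1\<close>.\<close>

definition linesearch_method ::
    "('a::real_inner \<Rightarrow> real) \<Rightarrow> ('a \<Rightarrow> real) \<Rightarrow> ('a \<Rightarrow> ereal) \<Rightarrow> real \<Rightarrow>
     real \<Rightarrow> (nat \<Rightarrow> 'a) \<Rightarrow> (nat \<Rightarrow> real) \<Rightarrow> bool" where
  "linesearch_method \<phi> f g \<alpha> l0 x lam \<longleftrightarrow>
     (\<forall>k. linesearch_step \<phi> f g \<alpha> (case k of 0 \<Rightarrow> l0 | Suc j \<Rightarrow> lam j)
            (x k) (x (Suc k)) (lam k))"

definition prox_model ::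
    "('a::real_inner \<Rightarrow> real) \<Rightarrow> ('a \<Rightarrow> real) \<Rightarrow> ('a \<Rightarrow> ereal) \<Rightarrow> real \<Rightarrow> 'a \<Rightarrow> ereal" where
  "prox_model \<phi> f g l xb =
     (INF x. ereal (f xb + episcale l \<phi> (x - xb + l *\<^sub>R conj_gradient \<phi> (gradient f xb))
               - episcale l \<phi> (l *\<^sub>R conj_gradient \<phi> (gradient f xb))) + g x)"

definition regularized_gap ::
    "('a::real_inner \<Rightarrow> real) \<Rightarrow> ('a \<Rightarrow> real) \<Rightarrow> ('a \<Rightarrow> ereal) \<Rightarrow> 'a \<Rightarrow> real \<Rightarrow> ereal" where
  "regularized_gap \<phi> f g xb l =
     ereal (1 / l) * (objective f g xb - prox_model \<phi> f g l xb)"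

end

theory Submission
  imports Defs
begin

text \<open>
  Write \<open>x\<^sup>k\<close> for the iterates, \<open>c = min l0 (\<alpha> / L)\<close> and \<open>F\<^sub>l(x)\<close> for the model value
  \<open>prox_model \<phi> f g l x\<close>. Everything rests on the chain
  \<open>F(x\<^sup>k\<^sup>+\<^sup>1) \<le> F\<^sub>c(x\<^sup>k) \<le> F(x\<^sup>k)\<close>.

  For the chain, \<open>\<lambda> \<star> \<phi> (w + \<lambda> d) - \<lambda> \<star> \<phi> (\<lambda> d)\<close> is the difference quotient
  \<open>(\<phi> (d + s w) - \<phi> d) / s\<close> of a convex function, with \<open>s = 1 / \<lambda>\<close>, hence nonincreasing in \<open>\<lambda>\<close> (\<open>episcale_increment_antimono\<close>).
  Therefore the descent property with constant \<open>L\<close> makes the linesearch accept every step-size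
  up to \<open>1 / L\<close>, so that no accepted step-size \<open>l\<close> is below \<open>c\<close>. The acceptance test says that
  \<open>F(x\<^sup>k\<^sup>+\<^sup>1) \<le> F\<^sub>l(x\<^sup>k)\<close>, and the same monotonicity gives \<open>F\<^sub>l(x\<^sup>k) \<le> F\<^sub>c(x\<^sup>k)\<close>. The upper bound in
  the chain is the choice \<open>x = x\<^sup>k\<close> in the infimum.

  The chain shows that \<open>F(x\<^sup>k)\<close> decreases to a real limit \<open>m\<close>, and summing
  \<open>F(x\<^sup>k) - F\<^sub>c(x\<^sup>k) \<le> F(x\<^sup>k) - F(x\<^sup>k\<^sup>+\<^sup>1)\<close> gives the rate.

  For stationarity, the idea is to pass to the limit in the model with the fixed step-size \<open>c\<close>
  instead of the varying accepted ones. The chain forces \<open>F\<^sub>c(x\<^sup>k)\<close> to tend to \<open>m\<close> too, and \<open>F\<^sub>c\<close> is an infimum of functions that are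
  continuous in the base point, so at a limit point \<open>x\<close> one gets \<open>m \<le> F\<^sub>c(x)\<close>
  (\<open>prox_model_limit\<close>). Lower semicontinuity of \<open>g\<close> gives \<open>F(x) \<le> m\<close>. Hence \<open>x\<close> minimizes
  its own model, whose smooth part has gradient \<open>\<nabla>f(x)\<close> there, and Fermat's rule applies
  (\<open>fixed_point_stationary\<close>).

  Both the continuity of the model and the gradient of its smooth part need that \<open>\<nabla>\<phi>\<^sup>*\<close> is a
  continuous inverse of \<open>\<nabla>\<phi>\<close>. This is derived from one estimate, the linear growth of a strictly
  convex function away from its minimizer (\<open>legendre_linear_growth\<close>).
\<close>

section \<open>Gradients\<close>

lemma gradient_eqI:
  assumes "GDERIV f x :> D"
  shows "gradient f x = D"
  unfolding gradient_def
proof (rule the_equality)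
  show "GDERIV f x :> D" by (rule assms)
next
  fix E assume "GDERIV f x :> E"
  then have "(\<lambda>h. h \<bullet> E) = (\<lambda>h. h \<bullet> D)"
    using assms unfolding gderiv_def by (rule has_derivative_unique)
  then have "(E - D) \<bullet> E = (E - D) \<bullet> D" by (rule fun_cong)
  then have "(E - D) \<bullet> (E - D) = 0" by (simp only: inner_diff_right)
  then show "E = D" by simp
qed

text \<open>In a Euclidean space the derivative is represented by a vector, and \<open>gradient_eqI\<close> identifies
  that vector with the definite description.\<close>

lemma GDERIV_gradient:
  fixes f :: "'a::euclidean_space \<Rightarrow> real"
  assumes "f differentiable (at x)"
  shows "GDERIV f x :> gradient f x"
proof -
  obtain f' where f': "(f has_derivative f') (at x)"
    using assms by (auto simp: differentiable_def)
  then interpret bounded_linear f' by (rule has_derivative_bounded_linear)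
  define D where "D = (\<Sum>b\<in>Basis. f' b *\<^sub>R b)"
  have "f' h = h \<bullet> D" for h
  proof -
    have "f' h = f' (\<Sum>b\<in>Basis. (h \<bullet> b) *\<^sub>R b)" by (simp add: euclidean_representation)
    also have "\<dots> = h \<bullet> D" by (simp add: sum scaleR D_def inner_sum_right mult.commute)
    finally show ?thesis .
  qed
  then have "GDERIV f x :> D" using f' by (metis gderiv_def ext)
  then show ?thesis using gradient_eqI by metis
qed

section \<open>Legendre functions with full domain\<close>

lemma gradient_inequality:
  fixes \<phi> :: "'a::euclidean_space \<Rightarrow> real"
  assumes cvx: "convex_on UNIV \<phi>" and diff: "\<phi> differentiable (at u)"
  shows "\<phi> u + gradient \<phi> u \<bullet> (y - u) \<le> \<phi> y"
proof -
  let ?h = "\<lambda>t::real. \<phi> (u + t *\<^sub>R (y - u))"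
  have "convex_on UNIV ?h"
  proof (rule convex_onI)
    fix t a b :: real assume t: "0 < t" "t < 1"
    have eq: "u + ((1 - t) *\<^sub>R a + t *\<^sub>R b) *\<^sub>R (y - u)
      = (1 - t) *\<^sub>R (u + a *\<^sub>R (y - u)) + t *\<^sub>R (u + b *\<^sub>R (y - u))"
      by (simp add: algebra_simps)
    show "?h ((1 - t) *\<^sub>R a + t *\<^sub>R b) \<le> (1 - t) * ?h a + t * ?h b"
      unfolding eq using t by (intro convex_onD[OF cvx]) auto
  qed simp
  moreover have "(?h has_field_derivative gradient \<phi> u \<bullet> (y - u)) (at 0)"
  proof -
    have "((\<lambda>t::real. u + t *\<^sub>R (y - u)) has_derivative (\<lambda>t. t *\<^sub>R (y - u))) (at 0)"
      by (auto intro!: derivative_eq_intros)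
    moreover have "(\<phi> has_derivative (\<lambda>h. h \<bullet> gradient \<phi> u)) (at (u + 0 *\<^sub>R (y - u)))"
      using GDERIV_gradient[OF diff] by (simp add: gderiv_def)
    ultimately have "(?h has_derivative (\<lambda>t. (t *\<^sub>R (y - u)) \<bullet> gradient \<phi> u)) (at 0)"
      by (rule has_derivative_compose)
    then show ?thesis
      by (rule has_derivative_imp_has_field_derivative) (simp add: inner_commute)
  qed
  ultimately have "?h 1 - ?h 0 \<ge> (gradient \<phi> u \<bullet> (y - u)) * (1 - 0)"
    by (intro convex_on_imp_above_tangent[where A = UNIV]) auto
  then show ?thesis by simp
qed

text \<open>A finite convex function that is differentiable has a subgradient everywhere, so that essential
  strict convexity can be applied to the whole space.\<close>

lemma legendre_real:
  fixes \<phi> :: "'a::euclidean_space \<Rightarrow> real"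
  assumes "legendre (\<lambda>z. ereal (\<phi> z))"
  shows legendre_convex_on: "convex_on UNIV \<phi>"
    and legendre_differentiable: "\<And>x. \<phi> differentiable (at x)"
    and legendre_strictly_convex: "strictly_convex_on UNIV (\<lambda>z. ereal (\<phi> z))"
proof -
  have dom: "edomain (\<lambda>z. ereal (\<phi> z)) = UNIV" by (simp add: edomain_def)
  show diff: "\<phi> differentiable (at x)" for x
    using assms by (simp add: legendre_def essentially_smooth_def dom)
  have "epigraph UNIV \<phi> = {(x, r). \<phi> x \<le> r}" by (auto simp: epigraph_def)
  then have "convex (epigraph UNIV \<phi>)"
    using assms by (simp add: legendre_def convex_fun_def)
  then show cvx: "convex_on UNIV \<phi>" by (simp add: convex_epigraph)
  have "gradient \<phi> x \<in> convex_subdiff (\<lambda>z. ereal (\<phi> z)) x" for x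
    using gradient_inequality[OF cvx diff] by (simp add: convex_subdiff_def)
  then have "UNIV \<subseteq> {x. convex_subdiff (\<lambda>z. ereal (\<phi> z)) x \<noteq> {}}" by blast
  then show "strictly_convex_on UNIV (\<lambda>z. ereal (\<phi> z))"
    using assms by (simp add: legendre_def essentially_strictly_convex_def)
qed

text \<open>Equality at \<open>y\<close> would make the tangent at \<open>u\<close> touch \<open>\<phi>\<close> at both ends of the segment, while
  strict convexity puts \<open>\<phi>\<close> below the chord at the midpoint.\<close>

lemma strict_gradient_inequality:
  fixes \<phi> :: "'a::euclidean_space \<Rightarrow> real"
  assumes leg: "legendre (\<lambda>z. ereal (\<phi> z))" and "y \<noteq> u"
  shows "\<phi> u + gradient \<phi> u \<bullet> (y - u) < \<phi> y"
proof -
  let ?p = "(1 - 1/2) *\<^sub>R u + (1/2::real) *\<^sub>R y"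
  have "ereal (\<phi> ?p) < ereal (1 - 1/2) * ereal (\<phi> u) + ereal (1/2) * ereal (\<phi> y)"
    by (rule legendre_strictly_convex[OF leg, unfolded strictly_convex_on_def, rule_format])
       (use \<open>y \<noteq> u\<close> in auto)
  then have 1: "\<phi> ?p < \<phi> u / 2 + \<phi> y / 2" by simp
  have "?p - u = (1/2) *\<^sub>R (y - u)"
    by (simp add: algebra_simps)
      (metis add.commute field_sum_of_halves scaleR_add_left scaleR_one)
  then have "gradient \<phi> u \<bullet> (?p - u) = (gradient \<phi> u \<bullet> (y - u)) / 2"
    by (metis inner_scaleR_right mult.commute times_divide_eq_right mult_1_right)
  then show ?thesis
    using 1 gradient_inequality[OF legendre_convex_on[OF leg] legendre_differentiable[OF leg], of u ?p]
    by linarith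
qed

text \<open>The function \<open>\<psi>\<close>, which is \<open>\<phi>\<close> minus its tangent at \<open>u\<close>, vanishes at \<open>u\<close> and is positive elsewhere. By
  compactness it has a positive minimum on the sphere of radius \<open>r\<close>, and convexity along rays from
  \<open>u\<close> propagates that minimum outward at a linear rate.\<close>

lemma legendre_linear_growth:
  fixes \<phi> :: "'a::euclidean_space \<Rightarrow> real"
  assumes leg: "legendre (\<lambda>z. ereal (\<phi> z))" and r: "r > 0"
  obtains c where "c > 0"
    and "\<And>x. norm (x - u) \<ge> r \<Longrightarrow> \<phi> u + gradient \<phi> u \<bullet> (x - u) + c * norm (x - u) \<le> \<phi> x"
proof -
  define \<psi> where "\<psi> x = \<phi> x - \<phi> u - gradient \<phi> u \<bullet> (x - u)" for x
  have "continuous_on UNIV \<phi>"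
    using legendre_differentiable[OF leg] differentiable_imp_continuous_within
    by (auto simp: continuous_on_eq_continuous_within)
  then have cont: "continuous_on (sphere u r) \<psi>"
    unfolding \<psi>_def by (intro continuous_intros) (auto intro: continuous_on_subset)
  have "sphere u r \<noteq> {}" using r by simp
  then obtain p where p: "p \<in> sphere u r" "\<And>q. q \<in> sphere u r \<Longrightarrow> \<psi> p \<le> \<psi> q"
    using continuous_attains_inf[OF compact_sphere _ cont] by blast
  have "p \<noteq> u" using p r by auto
  then have pos: "\<psi> p > 0"
    using strict_gradient_inequality[OF leg, of p u] by (simp add: \<psi>_def)
  show thesis
  proof
    show "\<psi> p / r > 0" using pos r by simp
  next
    fix x assume x: "norm (x - u) \<ge> r"
    define t where "t = r / norm (x - u)"
    have nz: "norm (x - u) > 0" using x r by linarith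
    then have t: "0 < t" "t \<le> 1" using x r by (simp_all add: t_def)
    define q where "q = (1 - t) *\<^sub>R u + t *\<^sub>R x"
    have qu: "q - u = t *\<^sub>R (x - u)" by (simp add: q_def algebra_simps)
    have "norm (q - u) = r"
      using nz r by (auto simp: qu t_def)
    then have "q \<in> sphere u r" by (simp add: dist_norm norm_minus_commute)
    then have "\<psi> p \<le> \<psi> q" by (rule p(2))
    also have "\<dots> \<le> t * \<psi> x"
    proof -
      have "\<phi> q \<le> (1 - t) * \<phi> u + t * \<phi> x"
        unfolding q_def using t by (intro convex_onD[OF legendre_convex_on[OF leg]]) auto
      then show ?thesis unfolding \<psi>_def qu by (simp add: algebra_simps)
    qed
    finally have "\<psi> p / r * norm (x - u) \<le> \<psi> x"
      using r nz by (simp add: t_def pos_le_divide_eq pos_divide_le_eq mult.commute)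
    then show "\<phi> u + gradient \<phi> u \<bullet> (x - u) + \<psi> p / r * norm (x - u) \<le> \<phi> x"
      by (simp add: \<psi>_def)
  qed
qed

text \<open>Tilting \<open>\<phi>\<close> by a slope \<open>v\<close> close to \<open>\<nabla>\<phi>(u)\<close> cannot beat the linear growth, so the points that
  matter in the supremum defining \<open>\<phi>\<^sup>*(v)\<close> stay within distance \<open>r\<close> of \<open>u\<close>. The first bound locates
  the maximizers, which gives continuity of \<open>\<nabla>\<phi>\<^sup>*\<close>; the second bounds \<open>\<phi>\<^sup>*(v)\<close> to first order,
  which gives its differentiability at \<open>\<nabla>\<phi>(u)\<close>.\<close>

lemma tilted_legendre_bound:
  fixes \<phi> :: "'a::euclidean_space \<Rightarrow> real"
  assumes leg: "legendre (\<lambda>z. ereal (\<phi> z))" and r: "r > 0"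
  obtains c where "c > 0"
    and "\<And>v x. \<lbrakk>norm (v - gradient \<phi> u) \<le> c; norm (x - u) \<ge> r\<rbrakk> \<Longrightarrow> v \<bullet> x - \<phi> x \<le> v \<bullet> u - \<phi> u"
    and "\<And>v x. norm (v - gradient \<phi> u) \<le> c \<Longrightarrow>
           v \<bullet> x - \<phi> x \<le> v \<bullet> u - \<phi> u + r * norm (v - gradient \<phi> u)"
proof -
  obtain c where c: "c > 0"
    and growth: "\<And>x. norm (x - u) \<ge> r \<Longrightarrow> \<phi> u + gradient \<phi> u \<bullet> (x - u) + c * norm (x - u) \<le> \<phi> x"
    using legendre_linear_growth[OF leg r, of u] by blast
  have far: "v \<bullet> x - \<phi> x \<le> v \<bullet> u - \<phi> u"
    if v: "norm (v - gradient \<phi> u) \<le> c" and x: "norm (x - u) \<ge> r" for v x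
  proof -
    have "(v - gradient \<phi> u) \<bullet> (x - u) \<le> norm (v - gradient \<phi> u) * norm (x - u)"
      by (rule norm_cauchy_schwarz)
    also have "\<dots> \<le> c * norm (x - u)" using v by (simp add: mult_right_mono)
    finally show ?thesis using growth[OF x] by (simp add: inner_diff_left inner_diff_right)
  qed
  show thesis
  proof (rule that[OF c far])
    fix v x assume v: "norm (v - gradient \<phi> u) \<le> c"
    show "v \<bullet> x - \<phi> x \<le> v \<bullet> u - \<phi> u + r * norm (v - gradient \<phi> u)"
    proof (cases "norm (x - u) \<ge> r")
      case True
      then show ?thesis using far[OF v] r by (smt (verit) mult_nonneg_nonneg norm_ge_zero)
    next
      case False
      have "(v - gradient \<phi> u) \<bullet> (x - u) \<le> norm (v - gradient \<phi> u) * norm (x - u)"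
        by (rule norm_cauchy_schwarz)
      also have "\<dots> \<le> norm (v - gradient \<phi> u) * r"
        using False by (intro mult_left_mono) auto
      finally show ?thesis
        using gradient_inequality[OF legendre_convex_on[OF leg] legendre_differentiable[OF leg], of u x]
        by (simp add: inner_diff_left inner_diff_right algebra_simps)
    qed
  qed
qed

text \<open>The choice \<open>x = u\<close> in the supremum bounds \<open>\<phi>\<^sup>*(v)\<close> from below by an affine function of slope \<open>u\<close>
  that is exact at \<open>\<nabla>\<phi>(u)\<close>, and \<open>tilted_legendre_bound\<close> bounds the excess by \<open>r\<close> times the
  distance to \<open>\<nabla>\<phi>(u)\<close>. Since \<open>r\<close> is arbitrary, the affine function is the first-order expansion.\<close>

lemma conj_gradient_gradient:
  fixes \<phi> :: "'a::euclidean_space \<Rightarrow> real"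
  assumes leg: "legendre (\<lambda>z. ereal (\<phi> z))"
  shows "conj_gradient \<phi> (gradient \<phi> u) = u"
proof -
  let ?C = "\<lambda>v. real_of_ereal (conj_fun (\<lambda>x. ereal (\<phi> x)) v)"
  let ?g = "gradient \<phi> u"
  have bounds: "\<exists>c>0. \<forall>v. norm (v - ?g) \<le> c \<longrightarrow>
      v \<bullet> u - \<phi> u \<le> ?C v \<and> ?C v \<le> v \<bullet> u - \<phi> u + r * norm (v - ?g)" if r: "r > 0" for r
  proof -
    obtain c where c: "c > 0" and up: "\<And>v x. norm (v - ?g) \<le> c \<Longrightarrow>
           v \<bullet> x - \<phi> x \<le> v \<bullet> u - \<phi> u + r * norm (v - ?g)"
      using tilted_legendre_bound[OF leg r, of u] by metis
    have "v \<bullet> u - \<phi> u \<le> ?C v \<and> ?C v \<le> v \<bullet> u - \<phi> u + r * norm (v - ?g)"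
      if v: "norm (v - ?g) \<le> c" for v
    proof -
      have 1: "conj_fun (\<lambda>x. ereal (\<phi> x)) v \<le> ereal (v \<bullet> u - \<phi> u + r * norm (v - ?g))"
        unfolding conj_fun_def using up[OF v] by (intro SUP_least) simp
      have 2: "ereal (v \<bullet> u - \<phi> u) \<le> conj_fun (\<lambda>x. ereal (\<phi> x)) v"
        unfolding conj_fun_def by (rule SUP_upper2[of u]) auto
      from 1 2 show ?thesis by (cases "conj_fun (\<lambda>x. ereal (\<phi> x)) v") auto
    qed
    then show ?thesis using c by blast
  qed
  have Cg: "?C ?g = ?g \<bullet> u - \<phi> u" using bounds[OF zero_less_one] by (auto dest: spec[of _ ?g])
  have "GDERIV ?C ?g :> u"
    unfolding gderiv_def has_derivative_at_alt
  proof (intro conjI allI impI)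
    show "bounded_linear (\<lambda>h. h \<bullet> u)" by (rule bounded_linear_inner_left)
    fix e :: real assume "e > 0"
    from bounds[OF this] obtain c where c: "c > 0" and b: "\<And>v. norm (v - ?g) \<le> c \<Longrightarrow>
      v \<bullet> u - \<phi> u \<le> ?C v \<and> ?C v \<le> v \<bullet> u - \<phi> u + e * norm (v - ?g)" by blast
    show "\<exists>d>0. \<forall>y. norm (y - ?g) < d \<longrightarrow>
        norm (?C y - ?C ?g - (y - ?g) \<bullet> u) \<le> e * norm (y - ?g)"
    proof (intro exI[of _ c] conjI allI impI c)
      fix y assume "norm (y - ?g) < c"
      then show "norm (?C y - ?C ?g - (y - ?g) \<bullet> u) \<le> e * norm (y - ?g)"
        using b[of y] unfolding Cg by (simp add: inner_diff_left)
    qed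
  qed
  then show ?thesis
    unfolding conj_gradient_def egradient_def by (rule gradient_eqI)
qed

text \<open>The maximizer in the supremum for the slope \<open>\<nabla>\<phi>(u')\<close> is \<open>u'\<close> alone; if the slope is close to
  \<open>\<nabla>\<phi>(u)\<close>, no point at distance \<open>r\<close> or more from \<open>u\<close> does better than \<open>u\<close>, so \<open>u'\<close> is closer than \<open>r\<close>.\<close>

lemma continuous_on_conj_gradient:
  fixes \<phi> :: "'a::euclidean_space \<Rightarrow> real"
  assumes leg: "legendre (\<lambda>z. ereal (\<phi> z))"
  shows "continuous_on (range (gradient \<phi>)) (conj_gradient \<phi>)"
  unfolding continuous_on_iff
proof (intro ballI allI impI)
  fix v and r :: real assume "v \<in> range (gradient \<phi>)" and r: "r > 0"
  then obtain u where u: "v = gradient \<phi> u" by blast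
  obtain c where c: "c > 0" and far: "\<And>v x. \<lbrakk>norm (v - gradient \<phi> u) \<le> c; norm (x - u) \<ge> r\<rbrakk> \<Longrightarrow>
      v \<bullet> x - \<phi> x \<le> v \<bullet> u - \<phi> u"
    using tilted_legendre_bound[OF leg r, of u] by metis
  show "\<exists>d>0. \<forall>v'\<in>range (gradient \<phi>). dist v' v < d \<longrightarrow>
      dist (conj_gradient \<phi> v') (conj_gradient \<phi> v) < r"
  proof (intro exI[of _ c] conjI ballI impI c)
    fix v' assume "v' \<in> range (gradient \<phi>)" and d: "dist v' v < c"
    then obtain u' where u': "v' = gradient \<phi> u'" by blast
    have "norm (u' - u) < r"
    proof (rule ccontr)
      assume "\<not> norm (u' - u) < r"
      then have "v' \<bullet> u' - \<phi> u' \<le> v' \<bullet> u - \<phi> u" and "u \<noteq> u'"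
        using far[of v' u'] d r by (auto simp: u dist_norm)
      then show False
        using strict_gradient_inequality[OF leg, of u u'] by (simp add: u' inner_diff_right)
    qed
    then show "dist (conj_gradient \<phi> v') (conj_gradient \<phi> v) < r"
      by (simp add: u u' conj_gradient_gradient[OF leg] dist_norm)
  qed
qed

section \<open>The anisotropic model\<close>

text \<open>With \<open>t = l / l'\<close>, the point \<open>d + w / l'\<close> is the convex combination of \<open>d\<close> and \<open>d + w / l\<close> with
  weights \<open>1 - t\<close> and \<open>t\<close>.\<close>

lemma episcale_increment_antimono:
  fixes \<phi> :: "'a::real_vector \<Rightarrow> real"
  assumes cvx: "convex_on UNIV \<phi>" and l: "0 < l" "l \<le> l'"
  shows "episcale l' \<phi> (w + l' *\<^sub>R d) - episcale l' \<phi> (l' *\<^sub>R d)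
       \<le> episcale l \<phi> (w + l *\<^sub>R d) - episcale l \<phi> (l *\<^sub>R d)"
proof -
  define t where "t = l / l'"
  have t: "0 < t" "t \<le> 1" "l' * t = l" using l by (auto simp: t_def)
  have "d + inverse l' *\<^sub>R w = (1 - t) *\<^sub>R d + t *\<^sub>R (d + inverse l *\<^sub>R w)"
    using l by (simp add: t_def scaleR_add_right scaleR_diff_left)
      (simp add: inverse_eq_divide)
  then have "\<phi> (d + inverse l' *\<^sub>R w) \<le> (1 - t) * \<phi> d + t * \<phi> (d + inverse l *\<^sub>R w)"
    using t by (simp add: convex_onD[OF cvx])
  then have "l' * (\<phi> (d + inverse l' *\<^sub>R w) - \<phi> d) \<le> l' * (t * (\<phi> (d + inverse l *\<^sub>R w) - \<phi> d))"
    using l by (intro mult_left_mono) (auto simp: algebra_simps)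
  also have "\<dots> = l * (\<phi> (d + inverse l *\<^sub>R w) - \<phi> d)"
    using t(3) by (simp add: mult.assoc[symmetric])
  finally show ?thesis
    using l by (simp add: episcale_def algebra_simps)
qed

lemma descent_imp_linesearch_accepts:
  assumes "anisotropic_descent \<phi> f L" "convex_on UNIV \<phi>" "L > 0" "0 < l" "l \<le> 1 / L"
  shows "linesearch_accepts \<phi> f l x z"
proof -
  let ?d = "conj_gradient \<phi> (gradient f x)"
  have "f z \<le> f x + (episcale (1/L) \<phi> (z - x + (1/L) *\<^sub>R ?d) - episcale (1/L) \<phi> ((1/L) *\<^sub>R ?d))"
    using assms(1) by (simp add: anisotropic_descent_def inverse_eq_divide add_diff_eq)
  also have "\<dots> \<le> f x + (episcale l \<phi> (z - x + l *\<^sub>R ?d) - episcale l \<phi> (l *\<^sub>R ?d))"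
    using episcale_increment_antimono[OF assms(2,4,5)] by simp
  finally show ?thesis
    by (simp add: linesearch_accepts_def forward_step_def algebra_simps)
qed

lemma prox_model_antimono:
  assumes "convex_on UNIV \<phi>" "0 < l" "l \<le> l'"
  shows "prox_model \<phi> f g l' x \<le> prox_model \<phi> f g l x"
  unfolding prox_model_def
proof (intro INF_mono')
  fix z
  let ?d = "conj_gradient \<phi> (gradient f x)"
  show "ereal (f x + episcale l' \<phi> (z - x + l' *\<^sub>R ?d) - episcale l' \<phi> (l' *\<^sub>R ?d)) + g z
      \<le> ereal (f x + episcale l \<phi> (z - x + l *\<^sub>R ?d) - episcale l \<phi> (l *\<^sub>R ?d)) + g z"
    using episcale_increment_antimono[OF assms, of "z - x" ?d] by (intro add_right_mono) simp
qed

lemma prox_model_le_objective: "prox_model \<phi> f g l x \<le> objective f g x"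
  unfolding prox_model_def objective_def by (rule INF_lower2[of x]) auto

text \<open>The trial point minimizes the model up to a constant, so its model value is the infimum, and the
  acceptance test bounds the objective by that value.\<close>

lemma linesearch_accepts_imp_objective_le_prox_model:
  assumes z: "z \<in> trial_points \<phi> f g l x" and acc: "linesearch_accepts \<phi> f l x z"
  shows "objective f g z \<le> prox_model \<phi> f g l x"
  unfolding prox_model_def
proof (rule INF_greatest)
  fix y
  let ?d = "conj_gradient \<phi> (gradient f x)"
  let ?s = "forward_step \<phi> f l x"
  have shift: "y - x + l *\<^sub>R ?d = y - ?s" for y
    by (simp add: forward_step_def)
  have min: "ereal (episcale l \<phi> (z - ?s)) + g z \<le> ereal (episcale l \<phi> (y - ?s)) + g y"
    using z by (auto simp: trial_points_def argmin_set_def is_arg_min_def not_less)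
  let ?K = "f x - episcale l \<phi> (l *\<^sub>R ?d)"
  have "objective f g z \<le> ereal ?K + (ereal (episcale l \<phi> (z - ?s)) + g z)"
  proof -
    have "objective f g z \<le> ereal (?K + episcale l \<phi> (z - ?s)) + g z"
      unfolding objective_def using acc
      by (intro add_right_mono) (simp add: linesearch_accepts_def)
    then show ?thesis by (simp add: add.assoc flip: plus_ereal.simps(1))
  qed
  also have "\<dots> \<le> ereal ?K + (ereal (episcale l \<phi> (y - ?s)) + g y)"
    using min by (rule add_left_mono)
  also have "\<dots> = ereal (f x + episcale l \<phi> (y - x + l *\<^sub>R ?d) - episcale l \<phi> (l *\<^sub>R ?d)) + g y"
    unfolding shift add.assoc[symmetric] by (simp add: algebra_simps)
  finally show "objective f g z \<le> \<dots>" .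
qed

lemma trial_point_finite:
  assumes "proper_fun g" "z \<in> trial_points \<phi> f g l x"
  shows "\<bar>g z\<bar> \<noteq> \<infinity>"
proof -
  obtain y where y: "g y < \<infinity>" using assms(1) by (auto simp: proper_fun_def edomain_def)
  let ?s = "forward_step \<phi> f l x"
  have "ereal (episcale l \<phi> (z - ?s)) + g z \<le> ereal (episcale l \<phi> (y - ?s)) + g y"
    using assms(2) by (auto simp: trial_points_def argmin_set_def is_arg_min_def not_less)
  then have "g z \<noteq> \<infinity>" using y by auto
  moreover have "g z \<noteq> -\<infinity>" using assms(1) by (simp add: proper_fun_def)
  ultimately show ?thesis by auto
qed

section \<open>The linesearch\<close>

text \<open>The bound \<open>\<alpha> / L\<close> arises when backtracking has occurred: the step-size before the accepted one was
  rejected, hence larger than \<open>1 / L\<close>, and was then multiplied by \<open>\<alpha>\<close>. The step-size \<open>l\<close>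
  at which the point was accepted is distinguished from \<open>lnext\<close>, which may have been enlarged.\<close>

lemma linesearch_stepE:
  assumes step: "linesearch_step \<phi> f g \<alpha> lp x x' lnext"
    and desc: "anisotropic_descent \<phi> f L" and cvx: "convex_on UNIV \<phi>"
    and "L > 0" "0 < \<alpha>" "\<alpha> < 1" "lp > 0"
  obtains l where "min lp (\<alpha> / L) \<le> l" "l \<le> lnext" "x' \<in> trial_points \<phi> f g l x"
    "linesearch_accepts \<phi> f l x x'"
proof -
  obtain T z where
    z: "\<forall>t\<le>T. z t \<in> trial_points \<phi> f g (\<alpha> ^ t * lp) x" and
    rej: "\<forall>t<T. \<not> linesearch_accepts \<phi> f (\<alpha> ^ t * lp) x (z t)" and
    acc: "linesearch_accepts \<phi> f (\<alpha> ^ T * lp) x (z T)" and x': "x' = z T" and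
    lnext: "lnext = (if ereal (\<alpha> ^ T * lp / \<alpha>) < prox_threshold \<phi> g
                 then \<alpha> ^ T * lp / \<alpha> else \<alpha> ^ T * lp)"
    using step unfolding linesearch_step_def by blast
  let ?l = "\<alpha> ^ T * lp"
  have pos: "\<alpha> ^ t * lp > 0" for t using assms by simp
  have "min lp (\<alpha> / L) \<le> ?l"
  proof (cases T)
    case (Suc t)
    then have "\<not> \<alpha> ^ t * lp \<le> 1 / L"
      using rej descent_imp_linesearch_accepts[OF desc cvx \<open>L > 0\<close> pos] by blast
    then have "\<alpha> * (1 / L) \<le> \<alpha> * (\<alpha> ^ t * lp)"
      using assms by (intro mult_left_mono) auto
    then show ?thesis using Suc by (simp add: mult.assoc min.coboundedI2)
  qed simp
  moreover have "?l \<le> lnext"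
    using pos[of T] assms unfolding lnext by (simp add: field_simps)
  ultimately show thesis using that z acc x' by blast
qed

text \<open>Since a step-size handed to the next iteration is at least the accepted one, the lower bound
  \<open>min l0 (\<alpha> / L)\<close> is inherited by all iterations.\<close>

lemma linesearch_method_sufficient_decrease:
  assumes meth: "linesearch_method \<phi> f g \<alpha> l0 x lam"
    and desc: "anisotropic_descent \<phi> f L" and cvx: "convex_on UNIV \<phi>" and g: "proper_fun g"
    and pos: "L > 0" "0 < \<alpha>" "\<alpha> < 1" "l0 > 0"
  shows "objective f g (x (Suc k)) \<le> prox_model \<phi> f g (min l0 (\<alpha> / L)) (x k)"
    and "\<bar>g (x (Suc k))\<bar> \<noteq> \<infinity>"
proof -
  let ?m = "min l0 (\<alpha> / L)"
  have m: "?m > 0" using pos by simp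
  have main: "(\<exists>l\<ge>?m. l \<le> lam k \<and> x (Suc k) \<in> trial_points \<phi> f g l (x k)
      \<and> linesearch_accepts \<phi> f l (x k) (x (Suc k)))" for k
  proof (induction k)
    case 0
    have "linesearch_step \<phi> f g \<alpha> l0 (x 0) (x (Suc 0)) (lam 0)"
      using meth unfolding linesearch_method_def by (metis old.nat.simps(4))
    then show ?case
      using linesearch_stepE[OF _ desc cvx pos] by metis
  next
    case (Suc k)
    then have ge: "?m \<le> lam k" by auto
    have "linesearch_step \<phi> f g \<alpha> (lam k) (x (Suc k)) (x (Suc (Suc k))) (lam (Suc k))"
      using meth unfolding linesearch_method_def by (metis old.nat.simps(5))
    moreover have "lam k > 0" using ge m by linarith
    ultimately obtain l where l: "min (lam k) (\<alpha> / L) \<le> l" "l \<le> lam (Suc k)"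
      "x (Suc (Suc k)) \<in> trial_points \<phi> f g l (x (Suc k))"
      "linesearch_accepts \<phi> f l (x (Suc k)) (x (Suc (Suc k)))"
      using linesearch_stepE[OF _ desc cvx pos(1-3)] by metis
    moreover have "?m \<le> l" using ge l(1) by linarith
    ultimately show ?case by blast
  qed
  from main[of k] obtain l where l: "?m \<le> l" "x (Suc k) \<in> trial_points \<phi> f g l (x k)"
    "linesearch_accepts \<phi> f l (x k) (x (Suc k))" by blast
  show "objective f g (x (Suc k)) \<le> prox_model \<phi> f g ?m (x k)"
    using linesearch_accepts_imp_objective_le_prox_model[OF l(2,3)]
      prox_model_antimono[OF cvx m l(1)] by (rule order_trans)
  show "\<bar>g (x (Suc k))\<bar> \<noteq> \<infinity>" using trial_point_finite[OF g l(2)] .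
qed

section \<open>Stationarity\<close>

text \<open>The limit inferior over the punctured neighbourhood is enough, although the sequence may visit
  \<open>x\<close> itself, because any value below \<open>g x\<close> is also exceeded at \<open>x\<close>.\<close>

lemma lsc_fun_sequentially:
  assumes lsc: "lsc_fun g" and xs: "xs \<longlonglongrightarrow> x" and lim: "(\<lambda>i. g (xs i)) \<longlonglongrightarrow> m"
  shows "g x \<le> m"
proof (rule dense_le)
  fix c assume "c < g x"
  moreover have "g x \<le> Liminf (at x) g" using lsc by (simp add: lsc_fun_def)
  ultimately have "\<forall>\<^sub>F y in at x. c < g y" by (simp add: le_Liminf_iff)
  then have "\<forall>\<^sub>F y in nhds x. c < g y"
    using \<open>c < g x\<close> by (auto simp: eventually_at_filter elim: eventually_mono)
  then have "\<forall>\<^sub>F i in sequentially. c \<le> g (xs i)"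
    using xs by (auto simp: filterlim_iff elim!: eventually_mono)
  then show "c \<le> m"
    using lim by (intro tendsto_lowerbound) auto
qed

text \<open>Minimality bounds the difference quotient of \<open>g\<close> against the slope \<open>- D\<close> from below by minus the
  first-order remainder of \<open>h\<close>.\<close>

lemma Fermat_rule_regular_subdiff:
  fixes h :: "'a::euclidean_space \<Rightarrow> real"
  assumes h: "GDERIV h x :> D" and fin: "\<bar>g x\<bar> \<noteq> \<infinity>"
    and min: "\<And>y. ereal (h x) + g x \<le> ereal (h y) + g y"
  shows "- D \<in> regular_subdiff g x"
proof -
  let ?e = "\<lambda>y. norm (h y - h x - (y - x) \<bullet> D) / norm (y - x)"
  obtain c where c: "g x = ereal c" using fin by auto
  have "(?e \<longlongrightarrow> 0) (at x)"
    using h unfolding gderiv_def has_derivative_iff_norm by blast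
  then have "((\<lambda>y. ereal (- ?e y)) \<longlongrightarrow> ereal (- 0)) (at x)"
    by (intro tendsto_intros)
  then have "Liminf (at x) (\<lambda>y. ereal (- ?e y)) = ereal (- 0)"
    by (intro lim_imp_Liminf) auto
  then have "0 = Liminf (at x) (\<lambda>y. ereal (- ?e y))"
    by (simp add: zero_ereal_def)
  also have "\<dots> \<le> Liminf (at x) (\<lambda>y. (g y - g x - ereal (- D \<bullet> (y - x))) / ereal (norm (y - x)))"
  proof (rule Liminf_mono)
    have "ereal (- ?e y) \<le> (g y - g x - ereal (- D \<bullet> (y - x))) / ereal (norm (y - x))"
      if "y \<noteq> x" for y
    proof (cases "g y")
      case (real b)
      have "c - b \<le> h y - h x" using min[of y] by (simp add: real c)
      then have "- norm (h y - h x - (y - x) \<bullet> D) \<le> b - c + D \<bullet> (y - x)"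
        by (simp add: inner_commute)
      then have "- ?e y \<le> (b - c + D \<bullet> (y - x)) / norm (y - x)"
        by (metis divide_right_mono minus_divide_left norm_ge_zero)
      then show ?thesis using \<open>y \<noteq> x\<close> by (simp add: real c)
    next
      case PInf
      then show ?thesis using \<open>y \<noteq> x\<close> by (simp add: c)
    next
      case MInf
      then show ?thesis using min[of y] by (simp add: c)
    qed
    then show "\<forall>\<^sub>F y in at x. ereal (- ?e y)
        \<le> (g y - g x - ereal (- D \<bullet> (y - x))) / ereal (norm (y - x))"
      by (auto simp: eventually_at_filter)
  qed
  finally show ?thesis using fin by (simp add: regular_subdiff_def)
qed

lemma regular_subdiff_subset_limiting_subdiff: "regular_subdiff g x \<subseteq> limiting_subdiff g x"
proof
  fix v assume "v \<in> regular_subdiff g x"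
  then show "v \<in> limiting_subdiff g x"
    unfolding limiting_subdiff_def
    by (intro CollectI conjI, simp add: regular_subdiff_def)
      (rule exI[of _ "\<lambda>_. x"], rule exI[of _ "\<lambda>_. v"], simp)
qed

text \<open>Epi-scaling stretches the argument and the value by the same factor, so slopes are unchanged.\<close>

lemma GDERIV_episcale:
  assumes "GDERIV \<phi> d :> D" "l > 0"
  shows "GDERIV (\<lambda>z. episcale l \<phi> (z - x + l *\<^sub>R d)) x :> D"
proof -
  have "((\<lambda>z. inverse l *\<^sub>R (z - x + l *\<^sub>R d)) has_derivative (\<lambda>h. inverse l *\<^sub>R h)) (at x)"
    by (auto intro!: derivative_eq_intros)
  moreover have "(\<phi> has_derivative (\<lambda>h. h \<bullet> D)) (at (inverse l *\<^sub>R (x - x + l *\<^sub>R d)))"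
    using assms by (simp add: gderiv_def)
  ultimately have "((\<lambda>z. \<phi> (inverse l *\<^sub>R (z - x + l *\<^sub>R d))) has_derivative
      (\<lambda>h. (inverse l *\<^sub>R h) \<bullet> D)) (at x)"
    by (rule has_derivative_compose)
  then have "((\<lambda>z. l * \<phi> (inverse l *\<^sub>R (z - x + l *\<^sub>R d))) has_derivative
      (\<lambda>h. l * ((inverse l *\<^sub>R h) \<bullet> D))) (at x)"
    by (rule has_derivative_mult_right)
  moreover have "(\<lambda>h. l * ((inverse l *\<^sub>R h) \<bullet> D)) = (\<lambda>h. h \<bullet> D)"
    using assms(2) by auto
  ultimately show ?thesis by (simp only: gderiv_def episcale_def)
qed

text \<open>At the base point the smooth part of the model has gradient \<open>\<nabla>\<phi>(\<nabla>\<phi>\<^sup>*(\<nabla>f(x))) = \<nabla>f(x)\<close>.\<close>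

lemma fixed_point_stationary:
  fixes \<phi> :: "'a::euclidean_space \<Rightarrow> real"
  assumes leg: "legendre (\<lambda>z. ereal (\<phi> z))"
    and rge: "gradient f x \<in> range (gradient \<phi>)"
    and l: "l > 0" and fin: "\<bar>g x\<bar> \<noteq> \<infinity>" and le: "objective f g x \<le> prox_model \<phi> f g l x"
  shows "- gradient f x \<in> limiting_subdiff g x"
proof -
  obtain d where d: "gradient f x = gradient \<phi> d" using rge by blast
  let ?h = "\<lambda>z. episcale l \<phi> (z - x + l *\<^sub>R d)"
  have "GDERIV ?h x :> gradient f x"
    unfolding d by (intro GDERIV_episcale GDERIV_gradient legendre_differentiable[OF leg] l)
  moreover have "ereal (?h x) + g x \<le> ereal (?h y) + g y" for y
  proof -
    have "objective f g x \<le> ereal (f x + ?h y - ?h x) + g y"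
      using le unfolding prox_model_def d conj_gradient_gradient[OF leg] le_INF_iff by simp
    then show ?thesis
      using fin by (cases "g x"; cases "g y") (auto simp: objective_def)
  qed
  ultimately have "- gradient f x \<in> regular_subdiff g x"
    using fin by (intro Fermat_rule_regular_subdiff[where h = ?h])
  then show ?thesis using regular_subdiff_subset_limiting_subdiff by blast
qed

text \<open>For each fixed competitor \<open>z\<close> the model is continuous in the base point, which makes the infimum
  over \<open>z\<close> upper semicontinuous.\<close>

lemma prox_model_limit:
  fixes \<phi> f :: "'a::euclidean_space \<Rightarrow> real"
  assumes leg: "legendre (\<lambda>z. ereal (\<phi> z))" and C1: "C1_fun f"
    and rge: "range (gradient f) \<subseteq> range (gradient \<phi>)"
    and xs: "xs \<longlonglongrightarrow> x" and lim: "(\<lambda>i. prox_model \<phi> f g l (xs i)) \<longlonglongrightarrow> m"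
    and "\<And>z. g z \<noteq> -\<infinity>"
  shows "m \<le> prox_model \<phi> f g l x"
  unfolding prox_model_def
proof (rule INF_greatest)
  fix z
  let ?d = "\<lambda>x. conj_gradient \<phi> (gradient f x)"
  let ?q = "\<lambda>x. f x + episcale l \<phi> (z - x + l *\<^sub>R ?d x) - episcale l \<phi> (l *\<^sub>R ?d x)"
  have "continuous_on UNIV (gradient f)" using C1 by (simp add: C1_fun_def)
  then have "continuous_on UNIV ?d"
    by (rule continuous_on_compose2[OF continuous_on_conj_gradient[OF leg]]) (rule rge)
  moreover have \<phi>: "continuous_on UNIV \<phi>"
    using legendre_differentiable[OF leg]
    by (simp add: continuous_on_eq_continuous_within differentiable_imp_continuous_within)
  moreover have "continuous_on UNIV f"
    using C1
    by (simp add: continuous_on_eq_continuous_within differentiable_imp_continuous_within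
      C1_fun_def)
  ultimately have "continuous_on UNIV ?q"
    unfolding episcale_def by (intro continuous_intros continuous_on_compose2[OF \<phi>]) auto
  then have "isCont ?q x" by (simp add: continuous_on_eq_continuous_at)
  then have "(\<lambda>i. ?q (xs i)) \<longlonglongrightarrow> ?q x" using xs by (rule isCont_tendsto_compose)
  then have "(\<lambda>i. ereal (?q (xs i)) + g z) \<longlonglongrightarrow> ereal (?q x) + g z"
    using assms(6) by (intro tendsto_add_ereal_general) auto
  then show "m \<le> ereal (?q x) + g z"
    by (rule LIMSEQ_le[OF lim]) (auto simp: prox_model_def intro: INF_lower)
qed

section \<open>Convergence\<close>

text \<open>If all \<open>K\<close> terms exceeded the bound, so would their average; but their sum is at most
  \<open>(a 0 - a K) / c\<close>.\<close>

lemma exists_small_term_of_telescoping: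
  fixes a p :: "nat \<Rightarrow> real"
  assumes "\<And>k. a (Suc k) \<le> p k" "\<And>k. I \<le> a k" "c > 0" "K \<ge> 1"
  shows "\<exists>k<K. 1 / c * (a k - p k) \<le> 1 / (real K * c) * (a 0 - I)"
proof (rule ccontr)
  assume "\<not> ?thesis"
  then have lt: "\<And>k. k < K \<Longrightarrow> 1 / (real K * c) * (a 0 - I) < 1 / c * (a k - p k)" by force
  have "a 0 - I = c * (\<Sum>k<K. 1 / (real K * c) * (a 0 - I))"
    using assms by simp
  also have "\<dots> < c * (\<Sum>k<K. 1 / c * (a k - p k))"
    using assms lt by (intro mult_strict_left_mono sum_strict_mono) (simp_all add: lessThan_empty_iff)
  also have "\<dots> = (\<Sum>k<K. a k - p k)" using assms by (simp add: sum_distrib_left)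
  also have "\<dots> \<le> (\<Sum>k<K. a k - a (Suc k))" using assms by (intro sum_mono) simp
  also have "\<dots> = a 0 - a K" by (rule sum_lessThan_telescope')
  also have "\<dots> \<le> a 0 - I" using assms by simp
  finally show False by simp
qed

theorem theorem5p5:
  fixes \<phi> f :: "real ^ 'n \<Rightarrow> real"
    and g :: "real ^ 'n \<Rightarrow> ereal"
    and L \<alpha> l0 :: real
    and x :: "nat \<Rightarrow> real ^ 'n"
    and lam :: "nat \<Rightarrow> real"
  assumes "legendre (\<lambda>z. ereal (\<phi> z))"
    and "C1_fun f"
    and "L > 0"
    and "anisotropic_descent \<phi> f L"
    and "proper_fun g"
    and "lsc_fun g"
    and "(INF z. objective f g z) > -\<infinity>"
    and "prox_threshold \<phi> g > 0"
    and "0 < \<alpha>" and "\<alpha> < 1"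
    and "0 < l0" and "ereal l0 < prox_threshold \<phi> g"
    and "linesearch_method \<phi> f g \<alpha> l0 x lam"
  shows "decseq (\<lambda>k. objective f g (x k))
    \<and> (\<exists>l::real. (\<lambda>k. objective f g (x k)) \<longlonglongrightarrow> ereal l)
    \<and> (\<forall>xs. (\<exists>r. strict_mono r \<and> (x \<circ> r) \<longlonglongrightarrow> xs) \<longrightarrow>
          0 \<in> (\<lambda>v. gradient f xs + v) ` limiting_subdiff g xs)
    \<and> (\<forall>K::nat. K \<ge> 1 \<longrightarrow>
          Min ((\<lambda>k. regularized_gap \<phi> f g (x k) (min l0 (\<alpha> / L))) ` {0..K - 1})
          \<le> ereal (1 / (real K * min l0 (\<alpha> / L)))
             * (objective f g (x 0) - (INF z. objective f g z)))"
proof -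
  define c where "c = min l0 (\<alpha> / L)"
  have c: "c > 0" using assms by (simp add: c_def)
  define F where "F k = objective f g (x k)" for k
  define P where "P k = prox_model \<phi> f g c (x k)" for k
  define I where "I = (INF z. objective f g z)"
  have gm: "\<And>z. g z \<noteq> -\<infinity>" using assms(5) by (simp add: proper_fun_def)
  note cvx = legendre_convex_on[OF assms(1)]
  note dec = linesearch_method_sufficient_decrease
    [OF assms(13,4) cvx assms(5,3,9-11)]
  have FP: "F (Suc k) \<le> P k" and PF: "P k \<le> F k" for k
    using dec(1) prox_model_le_objective by (auto simp: F_def P_def c_def)
  have F_Suc: "\<bar>F (Suc k)\<bar> \<noteq> \<infinity>" for k
    using dec(2)[of k] by (cases "g (x (Suc k))") (auto simp: F_def objective_def)
  have IF: "I \<le> F k" for k unfolding I_def F_def by (rule INF_lower) simp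
  obtain i where i: "I = ereal i"
    using assms(7) IF[of 1] F_Suc[of 0] by (cases I) (auto simp: I_def)

  have dseq: "decseq F" using order_trans[OF FP PF] by (rule decseq_SucI)
  then have "F \<longlonglongrightarrow> (INF k. F k)" by (rule LIMSEQ_INF)
  moreover have "\<bar>INF k. F k\<bar> \<noteq> \<infinity>"
  proof -
    have "I \<le> (INF k. F k)" using IF by (intro INF_greatest)
    moreover have "(INF k. F k) \<le> F 1" by (rule INF_lower) simp
    ultimately show ?thesis using i F_Suc[of 0] by auto
  qed
  ultimately obtain l where l: "F \<longlonglongrightarrow> ereal l" by (metis ereal_real')

  \<comment> \<open>\<open>F(xs) \<le> l \<le> F\<^sub>c(xs)\<close>, with \<open>l\<close> the common limit of \<open>F\<close> and \<open>P\<close>: the first inequality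
    by lower semicontinuity, the second by \<open>prox_model_limit\<close>.\<close>
  have stat: "- gradient f xs \<in> limiting_subdiff g xs"
    if r: "strict_mono r" and xr: "(x \<circ> r) \<longlonglongrightarrow> xs" for xs r
  proof (rule fixed_point_stationary[OF assms(1) _ c])
    have "(\<lambda>k. F (Suc k)) \<longlonglongrightarrow> ereal l" using l by (rule LIMSEQ_Suc)
    then have "P \<longlonglongrightarrow> ereal l"
      using l by (rule tendsto_sandwich[rotated 2]) (auto simp: FP PF)
    then have "(P \<circ> r) \<longlonglongrightarrow> ereal l" using r by (rule LIMSEQ_subseq_LIMSEQ)
    then have Pr: "(\<lambda>k. prox_model \<phi> f g c ((x \<circ> r) k)) \<longlonglongrightarrow> ereal l"
      by (simp add: P_def o_def)
    have rge: "range (gradient f) \<subseteq> range (gradient \<phi>)"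
      using assms(4) by (simp add: anisotropic_descent_def)
    then show "gradient f xs \<in> range (gradient \<phi>)" by blast
    have up: "ereal l \<le> prox_model \<phi> f g c xs"
      by (rule prox_model_limit[OF assms(1,2) rge xr Pr gm])
    have "isCont f xs"
      using assms(2) by (simp add: C1_fun_def differentiable_imp_continuous_within)
    then have "(\<lambda>k. f (x (r k))) \<longlonglongrightarrow> f xs"
      using xr by (auto simp: o_def intro: isCont_tendsto_compose)
    moreover have "(\<lambda>k. F (r k)) \<longlonglongrightarrow> ereal l"
      using LIMSEQ_subseq_LIMSEQ[OF l r] by (simp add: o_def)
    ultimately have "(\<lambda>k. F (r k) - ereal (f (x (r k)))) \<longlonglongrightarrow> ereal l - ereal (f xs)"
      by (intro tendsto_diff_ereal) auto
    moreover have "F k - ereal (f (x k)) = g (x k)" for k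
      by (cases "g (x k)") (auto simp: F_def objective_def)
    ultimately have "(\<lambda>k. g ((x \<circ> r) k)) \<longlonglongrightarrow> ereal (l - f xs)" by simp
    then have low: "g xs \<le> ereal (l - f xs)"
      by (rule lsc_fun_sequentially[OF assms(6) xr])
    then show "\<bar>g xs\<bar> \<noteq> \<infinity>" using gm[of xs] by auto
    have "objective f g xs \<le> ereal l"
      using low gm[of xs] by (cases "g xs") (auto simp: objective_def)
    then show "objective f g xs \<le> prox_model \<phi> f g c xs" using up by (rule order_trans)
  qed

  have rate: "Min ((\<lambda>k. regularized_gap \<phi> f g (x k) c) ` {0..K - 1})
          \<le> ereal (1 / (real K * c)) * (F 0 - I)" if K: "K \<ge> 1" for K
  proof (cases "F 0 = \<infinity>")
    \<comment> \<open>The starting point may lie outside the domain of \<open>g\<close>; then the right-hand side is infinite.\<close>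
    case True
    then show ?thesis using K c by (simp add: i)
  next
    case False
    have "\<bar>F k\<bar> \<noteq> \<infinity>" for k
      using False F_Suc IF[of 0] i by (cases k) auto
    then obtain a where a: "\<And>k. F k = ereal (a k)"
      by (intro that[of "\<lambda>k. real_of_ereal (F k)"]) (simp add: ereal_real')
    have "\<bar>P k\<bar> \<noteq> \<infinity>" for k using FP[of k] PF[of k] a by auto
    then obtain p where p: "\<And>k. P k = ereal (p k)"
      by (intro that[of "\<lambda>k. real_of_ereal (P k)"]) (simp add: ereal_real')
    have gap: "regularized_gap \<phi> f g (x k) c = ereal (1 / c * (a k - p k))" for k
      using a[of k] p[of k] by (simp add: regularized_gap_def F_def P_def)
    have "\<exists>k<K. 1 / c * (a k - p k) \<le> 1 / (real K * c) * (a 0 - i)"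
      using FP IF a p i K c by (intro exists_small_term_of_telescoping) (auto simp flip: ereal_less_eq(3))
    then obtain k where k: "k < K" "1 / c * (a k - p k) \<le> 1 / (real K * c) * (a 0 - i)" by blast
    have "Min ((\<lambda>k. regularized_gap \<phi> f g (x k) c) ` {0..K - 1}) \<le> regularized_gap \<phi> f g (x k) c"
      using k(1) by (intro Min_le) auto
    also have "\<dots> \<le> ereal (1 / (real K * c)) * (F 0 - I)"
      using k(2) by (simp add: gap a i)
    finally show ?thesis .
  qed

  have "0 \<in> (\<lambda>v. gradient f xs + v) ` limiting_subdiff g xs"
    if "strict_mono r" "(x \<circ> r) \<longlonglongrightarrow> xs" for xs r
    by (rule image_eqI[OF _ stat[OF that]]) simp
  then show ?thesis
    using dseq l rate unfolding F_def I_def c_def by blast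
qed

end
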